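(* Suppose that $\sigma=\{z_i\}_{i=1}^m$ consists of the vertices of a convex polygon, listed so that $z_1,\dots,z_m$ are consecutive vertices when the boundary of the polygon is followed anticlockwise, and let $f:\sigma\to\mathbb{C}$. Then $$\frac12\Bigl(|f(z_m)-f(z_1)|+\sum_{i=1}^{m-1}|f(z_i)-f(z_{i+1})|\Bigr)\le \mathrm{var}(f,\sigma)\le \sum_{i=1}^{m-1}|f(z_i)-f(z_{i+1})|.$$
   Context: Identify $\mathbb{C}$ with $\mathbb{R}^2$. A list $S=[x_0,x_1,\dots,x_n]$ ($n\ge 0$) is a finite ordered list of points of the plane; repetitions are allowed. For a line $\ell$ in the plane and $n\ge 1$, the segment $\overline{x_j\,x_{j+1}}$ ($0\le j<n$) is a crossing segment of $S$ on $\ell$ if one of the following holds: (1) $x_j$ and $x_{j+1}$ lie on strictly opposite sides of $\ell$; (2) $j=0$ and $x_0\in\ell$; (3) $x_j\notin\ell$ and $x_{j+1}\in\ell$. Let $\mathrm{vf}(S,\ell)$ be the number of crossing segments of $S$ on $\ell$ (counted by index $j$); for $n=0$ put $\mathrm{vf}([x_0],\ell)=1$ if $x_0\in\ell$ and $0$ otherwise. The variation factor is $\mathrm{vf}(S)=\max_\ell \mathrm{vf}(S,\ell)$, the maximum over all lines in the plane. For a nonempty compact set $\sigma$ in the plane, $f:\sigma\to\mathbb{C}$ and a list $S=[x_0,\dots,x_n]$ of elements of $\sigma$, put $\mathrm{cvar}(f,S)=\sum_{i=1}^n|f(x_i)-f(x_{i-1})|$ (equal to $0$ if $n=0$), and $\mathrm{var}(f,\sigma)=\sup_S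 \mathrm{cvar}(f,S)/\mathrm{vf}(S)\in[0,\infty]$, the supremum over all finite ordered lists of elements of $\sigma$. *)

theory Defs
  imports "HOL-Analysis.Analysis"
begin

section \<open>Variation over a set in the plane\<close>

definition is_line :: "complex set \<Rightarrow> bool" where
  "is_line L \<longleftrightarrow> affine L \<and> aff_dim L = 1"

text \<open>The two sides of a line are the open half-planes given by an equation of it; the choice of
  the equation does not matter, and negating it shows that the relation is symmetric.\<close>

definition strictly_opposite_sides :: "complex set \<Rightarrow> complex \<Rightarrow> complex \<Rightarrow> bool" where
  "strictly_opposite_sides L x y \<longleftrightarrow>
     (\<exists>a b. a \<noteq> 0 \<and> L = {w. a \<bullet> w = b} \<and> a \<bullet> x < b \<and> b < a \<bullet> y)"

definition crossing_segment :: "complex list \<Rightarrow> complex set \<Rightarrow> nat \<Rightarrow> bool" where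
  "crossing_segment S L j \<longleftrightarrow>
     strictly_opposite_sides L (S ! j) (S ! Suc j) \<or>
     j = 0 \<and> S ! 0 \<in> L \<or>
     S ! j \<notin> L \<and> S ! Suc j \<in> L"

text \<open>All notions below concern nonempty lists; a list $[x_0,\dots,x_n]$ has length $n+1$.\<close>

definition vf_line :: "complex list \<Rightarrow> complex set \<Rightarrow> nat" where
  "vf_line S L =
     (if length S = 1 then (if S ! 0 \<in> L then 1 else 0)
      else card {j. j < length S - 1 \<and> crossing_segment S L j})"

definition vf :: "complex list \<Rightarrow> nat" where
  "vf S = Max {vf_line S L | L. is_line L}"

lemma finite_vf_line: "finite {vf_line S L | L. is_line L}"
proof (rule finite_subset)
  have "card {j. j < length S - 1 \<and> crossing_segment S L j} \<le> card {..<length S - 1}" for L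
    by (rule card_mono) auto
  then show "{vf_line S L | L. is_line L} \<subseteq> {..max 1 (length S - 1)}"
    by (fastforce simp: vf_line_def intro: le_trans)
qed simp

definition cvar :: "(complex \<Rightarrow> complex) \<Rightarrow> complex list \<Rightarrow> real" where
  "cvar f S = (\<Sum>i = 1..length S - 1. cmod (f (S ! i) - f (S ! (i - 1))))"

text \<open>Only the values of \<open>f\<close> on \<open>\<sigma>\<close> matter. For a nonempty list, \<open>vf\<close> is at least 1, witnessed by
  any line through its first point, so the quotient is never a division by zero.\<close>

definition variation :: "(complex \<Rightarrow> complex) \<Rightarrow> complex set \<Rightarrow> ereal" where
  "variation f \<sigma> = (SUP S \<in> {S. S \<noteq> [] \<and> set S \<subseteq> \<sigma>}. ereal (cvar f S / real (vf S)))"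

section \<open>Convex polygons\<close>

definition convex_polygon :: "complex set \<Rightarrow> bool" where
  "convex_polygon P \<longleftrightarrow> polytope P \<and> aff_dim P = 2"

text \<open>\<open>w\<close> lies strictly to the left of the directed line from \<open>a\<close> to \<open>b\<close>: the imaginary part is the
  determinant of \<open>b - a\<close> and \<open>w - a\<close>.\<close>

definition left_of :: "complex \<Rightarrow> complex \<Rightarrow> complex \<Rightarrow> bool" where
  "left_of a b w \<longleftrightarrow> Im (cnj (b - a) * (w - a)) > 0"

text \<open>\<open>z 1, \<dots>, z m\<close> lists the vertices of \<open>P\<close>, each once, so that cyclically consecutive ones
  are joined by an edge of \<open>P\<close>. Following the boundary anticlockwise means that the interior
  is to the left of each edge.\<close>

definition anticlockwise_vertices :: "complex set \<Rightarrow> nat \<Rightarrow> (nat \<Rightarrow> complex) \<Rightarrow> bool" where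
  "anticlockwise_vertices P m z \<longleftrightarrow>
     bij_betw z {1..m} {v. v extreme_point_of P} \<and>
     (\<forall>i\<in>{1..m}. let a = z i; b = z (if i = m then 1 else i + 1) in
        closed_segment a b edge_of P \<and> (\<forall>w\<in>interior P. left_of a b w))"

end

theory Submission imports Defs "HOL-Real_Asymp.Real_Asymp" begin

text \<open>Both bounds rest on the fact that consecutive vertices of the polygon are in convex position:
  any three of them, taken in increasing order of index, form a positively oriented triangle.
  For the upper bound, the line through the midpoints of the edges from \<open>z m\<close> to \<open>z 1\<close> and
  from \<open>z i\<close> to \<open>z (i + 1)\<close> separates \<open>z 1, \<dots>, z i\<close> from the other vertices, so at most
  \<open>vf S\<close> segments of a list \<open>S\<close> jump over the gap between \<open>i\<close> and \<open>i + 1\<close>; the triangle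
  inequality along the vertices then gives the claim. For the lower bound, going around the boundary
  \<open>N\<close> times crosses a line at most \<open>2 N + 1\<close> times, where the extra crossing comes from
  the starting point; let \<open>N\<close> tend to infinity.\<close>

section \<open>Signed areas of triangles\<close>

text \<open>Twice the signed area of the triangle \<open>a b c\<close>; \<open>left_of a b c\<close>
  says that it is positive.\<close>

definition orient :: "complex \<Rightarrow> complex \<Rightarrow> complex \<Rightarrow> real" where
  "orient a b c = Im (cnj (b - a) * (c - a))"

lemma orient_rotate: "orient b c a = orient a b c"
  by (simp add: orient_def algebra_simps)

lemma orient_degenerate [simp]: "orient a a c = 0" "orient a b a = 0" "orient a b b = 0"
  by (simp_all add: orient_def algebra_simps)

text \<open>The three-term Grassmann-Pluecker relation for determinants of vectors based at
  \<open>o'\<close>.\<close>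

lemma orient_pluecker:
  "orient o' a c * orient o' b d = orient o' a b * orient o' c d + orient o' a d * orient o' b c"
  by (simp add: orient_def algebra_simps)

text \<open>Four points of the plane are affinely dependent, with signed areas as coefficients. For
  an anticlockwise convex quadrilateral \<open>a b c d\<close> all four are positive, and both sides
  are, up to one factor, the value at the intersection of the diagonals;
  \<open>orient_relation\<close> says that the total weights agree.\<close>

lemma orient_relation_inner:
  "orient b c d * (v \<bullet> a) + orient a b d * (v \<bullet> c) = orient a c d * (v \<bullet> b) + orient a b c * (v \<bullet> d)"
  by (simp add: orient_def inner_complex_def algebra_simps)

lemma orient_relation:
  "orient b c d + orient a b d = orient a c d + orient a b c"
  by (simp add: orient_def algebra_simps)

text \<open>\<open>orient\<close> is affine in each argument, so at midpoints it is a mean.\<close>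

lemma orient_midpoints:
  "4 * orient (midpoint a b) (midpoint c d) w =
     orient a c w + orient a d w + orient b c w + orient b d w"
  by (simp add: orient_def midpoint_def field_simps)

text \<open>Multiplication by \<open>\<i>\<close> is a quarter turn, so
  \<open>\<i> * (q - p)\<close> is a normal of the line from \<open>p\<close> to \<open>q\<close>,
  pointing to its left.\<close>

lemma orient_eq_inner: "orient p q w = (\<i> * (q - p)) \<bullet> w - (\<i> * (q - p)) \<bullet> p"
  by (simp add: orient_def inner_complex_def algebra_simps)

lemma orient_zero_imp_collinear:
  assumes "orient a b c = 0"
  shows "collinear {a, b, c}"
proof (cases "a = b")
  case False
  define r where "r = Re (cnj (b - a) * (c - a))"
  define t where "t = r / (cmod (b - a))\<^sup>2"
  have "cnj (b - a) * (c - a) = of_real r"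
    using assms by (simp add: r_def orient_def complex_eq_iff)
  then have "of_real ((cmod (b - a))\<^sup>2) * (c - a) = (b - a) * of_real r"
    by (simp only: complex_norm_square mult.assoc)
  then have "c - a = of_real t * (b - a)"
    using False by (simp add: t_def field_simps)
  then have "c = a + t *\<^sub>R (b - a)"
    by (simp add: scaleR_conv_of_real algebra_simps)
  then have "b = a + 1 *\<^sub>R (b - a)" "a = a + 0 *\<^sub>R (b - a)" "c = a + t *\<^sub>R (b - a)"
    by simp_all
  then have "\<forall>x\<in>{a, b, c}. \<exists>s. x = a + s *\<^sub>R (b - a)" by blast
  then show ?thesis unfolding collinear_alt by blast
qed simp

section \<open>Convex position\<close>

definition convex_position :: "nat \<Rightarrow> (nat \<Rightarrow> complex) \<Rightarrow> bool" where
  "convex_position m z \<longleftrightarrow>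
     (\<forall>i j k. 1 \<le> i \<and> i < j \<and> j < k \<and> k \<le> m \<longrightarrow> 0 < orient (z i) (z j) (z k))"

lemma convex_positionD:
  "convex_position m z \<Longrightarrow> 1 \<le> i \<Longrightarrow> i < j \<Longrightarrow> j < k \<Longrightarrow> k \<le> m \<Longrightarrow> 0 < orient (z i) (z j) (z k)"
  by (simp add: convex_position_def)

lemma convex_position_weak:
  assumes "convex_position m z" "1 \<le> i" "i \<le> j" "j \<le> k" "k \<le> m"
  shows "0 \<le> orient (z i) (z j) (z k)"
  using assms convex_positionD[OF assms(1), of i j k]
  by (cases "i = j \<or> j = k") (auto simp: order.strict_iff_order)

text \<open>Seen from \<open>z i\<close>, the later vertices lie to the left of the direction of \<open>z (i + 1)\<close> and
  turn left from each one to the next; in a half-plane the relation of being to the left is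
  transitive.\<close>

lemma convex_position_if_edges:
  assumes edge: "\<And>i k. 1 \<le> i \<Longrightarrow> i < m \<Longrightarrow> k \<in> {1..m} \<Longrightarrow> k \<noteq> i \<Longrightarrow> k \<noteq> i + 1
                   \<Longrightarrow> 0 < orient (z i) (z (i + 1)) (z k)"
  shows "convex_position m z"
  unfolding convex_position_def
proof (intro allI impI, elim conjE)
  fix i j k assume "1 \<le> i" "i < j" "j < k" "k \<le> m"
  have "j < k \<longrightarrow> k \<le> m \<longrightarrow> 0 < orient (z i) (z j) (z k)" for k
  proof (induction k)
    case (Suc k)
    show ?case
    proof (intro impI)
      assume k: "j < Suc k" "Suc k \<le> m"
      have step: "0 < orient (z i) (z k) (z (Suc k))" if "i < k"
        \<comment> \<open>The edge from \<open>z k\<close> to \<open>z (k + 1)\<close> has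
          \<open>z i\<close> on its left; the triangle is then rotated cyclically.\<close>
        using edge[of k i] that k \<open>1 \<le> i\<close> orient_rotate[of "z k" "z (Suc k)" "z i"] by simp
      show "0 < orient (z i) (z j) (z (Suc k))"
      proof (cases "j = k \<or> j = i + 1")
        case True
        then show ?thesis using step edge[of i "Suc k"] k \<open>1 \<le> i\<close> \<open>i < j\<close> by auto
      next
        case False
        then have jk: "j < k" and ij: "i + 1 < j" using k \<open>i < j\<close> by auto
        have *: "0 < orient (z i) (z (i+1)) (z l)" if "l \<in> {j, k, Suc k}" for l
          using that edge[of i l] jk ij k \<open>1 \<le> i\<close> by auto
        moreover have "0 < orient (z i) (z j) (z k)" using Suc jk k by auto
        moreover have "0 < orient (z i) (z k) (z (Suc k))" using step jk ij by simp
        \<comment> \<open>In the Pluecker relation based at \<open>z i\<close>, all factors on the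
          right are positive by the edge at \<open>i\<close>, the induction hypothesis and
          \<open>step\<close>.\<close>
        ultimately have "0 < orient (z i) (z (i+1)) (z k) * orient (z i) (z j) (z (Suc k))"
          by (subst orient_pluecker, intro add_pos_pos mult_pos_pos) auto
        moreover have "0 < orient (z i) (z (i+1)) (z k)" using * by simp
        ultimately show ?thesis by (simp add: zero_less_mult_iff)
      qed
    qed
  qed simp
  then show "0 < orient (z i) (z j) (z k)" using \<open>j < k\<close> \<open>k \<le> m\<close> by blast
qed

section \<open>Vertices of a convex polygon\<close>

text \<open>Of three distinct collinear points one lies in the open segment between the others,
  which is impossible for an extreme point.\<close>

lemma extreme_points_not_collinear:
  fixes a b c :: "'a::euclidean_space"
  assumes "a extreme_point_of P" "b extreme_point_of P" "c extreme_point_of P"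
    and "a \<noteq> b" "b \<noteq> c" "a \<noteq> c"
  shows "\<not> collinear {a, b, c}"
proof
  assume "collinear {a, b, c}"
  then have "between (b, c) a \<or> between (c, a) b \<or> between (a, b) c"
    by (rule collinear_between_cases[THEN iffD1])
  then show False
    using assms by (auto simp: between_mem_segment extreme_point_of_def open_segment_def)
qed

text \<open>By Krein-Milman the extreme points have the affine dimension of \<open>P\<close>, and
  dimension 2 takes three points.\<close>

lemma polygon_vertex_count:
  assumes "convex_polygon P" "anticlockwise_vertices P m z"
  shows "3 \<le> m"
proof -
  have bij: "bij_betw z {1..m} {v. v extreme_point_of P}"
    using assms by (simp add: anticlockwise_vertices_def)
  have "P = convex hull {v. v extreme_point_of P}"
    using assms by (intro Krein_Milman_Minkowski)
      (auto simp: convex_polygon_def polytope_imp_compact polytope_imp_convex)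
  then have "aff_dim {v. v extreme_point_of P} = 2"
    using assms by (metis aff_dim_convex_hull convex_polygon_def)
  moreover have "finite {v. v extreme_point_of P}" using bij bij_betw_finite by blast
  ultimately show ?thesis
    using aff_dim_le_card[of "{v. v extreme_point_of P}"] bij_betw_same_card[OF bij] by simp
qed

text \<open>A convex set with nonempty interior lies in the closure of its interior, so every vertex
  is weakly to the left of the edge at \<open>i\<close>; zero area would make three extreme points
  collinear.\<close>

lemma polygon_convex_position:
  assumes "convex_polygon P" "anticlockwise_vertices P m z"
  shows "convex_position m z"
proof (rule convex_position_if_edges)
  fix i k assume ik: "1 \<le> i" "i < m" "k \<in> {1..m}" "k \<noteq> i" "k \<noteq> i + 1"
  have bij: "bij_betw z {1..m} {v. v extreme_point_of P}"
    using assms by (simp add: anticlockwise_vertices_def)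
  have ext: "z l extreme_point_of P" if "l \<in> {1..m}" for l
    using bij_betwE[OF bij] that by blast
  have left: "interior P \<subseteq> {w. 0 < orient (z i) (z (i + 1)) w}"
    using assms(2) ik
    by (auto simp: anticlockwise_vertices_def left_of_def orient_def Let_def
        dest!: bspec[of _ _ i])
  have "convex P" "aff_dim P = 2"
    using assms by (auto simp: convex_polygon_def polytope_imp_convex)
  then have "interior P \<noteq> {}"
    using interior_rel_interior_gen[of P] rel_interior_eq_empty[of P] by auto
  then have "P \<subseteq> closure (interior P)"
    using convex_closure_interior[OF \<open>convex P\<close>] closure_subset by blast
  also have "\<dots> \<subseteq> {w. 0 \<le> orient (z i) (z (i + 1)) w}"
    using left unfolding orient_def
    by (intro closure_minimal closed_Collect_le continuous_intros) (auto intro: less_imp_le)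
  finally have "0 \<le> orient (z i) (z (i + 1)) (z k)"
    using ext[OF ik(3)] by (auto simp: extreme_point_of_def)
  moreover have "orient (z i) (z (i + 1)) (z k) \<noteq> 0"
  proof
    assume "orient (z i) (z (i + 1)) (z k) = 0"
    then have "collinear {z i, z (i + 1), z k}" by (rule orient_zero_imp_collinear)
    moreover have "z i \<noteq> z (i + 1)" "z (i + 1) \<noteq> z k" "z i \<noteq> z k"
      using ik bij_betw_imp_inj_on[OF bij] by (auto simp: inj_on_eq_iff)
    ultimately show False
      using extreme_points_not_collinear ext ik
      by (metis atLeastAtMost_iff less_eq_Suc_le Suc_eq_plus1 less_imp_le le_add2)
  qed
  ultimately show "0 < orient (z i) (z (i + 1)) (z k)" by linarith
qed

section \<open>Separation of vertices by lines\<close>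

lemma is_line_hyperplane: "a \<noteq> 0 \<Longrightarrow> is_line {w. a \<bullet> w = b}"
  by (simp add: is_line_def affine_hyperplane)

lemma is_lineE:
  assumes "is_line L"
  obtains a b where "a \<noteq> 0" "L = {w. a \<bullet> w = b}"
proof -
  have "\<exists>a b. a \<noteq> 0 \<and> affine hull L = {w. a \<bullet> w = b}"
    by (rule aff_dim_eq_hyperplane[THEN iffD1]) (use assms in \<open>simp add: is_line_def\<close>)
  moreover have "affine hull L = L" using assms by (simp add: is_line_def affine_hull_eq)
  ultimately have "\<exists>a b. a \<noteq> 0 \<and> L = {w. a \<bullet> w = b}" by (simp only:)
  then show ?thesis by (elim exE conjE) (rule that)
qed

text \<open>By \<open>orient_midpoints\<close>, the side on which \<open>z k\<close> lies is the
  sign of a sum of four areas, to which convex position gives a common weak sign.\<close>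

lemma convex_position_separating_line:
  assumes cp: "convex_position m z" and "3 \<le> m" "1 \<le> i" "i < m"
  obtains a b where "\<And>k. 1 \<le> k \<Longrightarrow> k \<le> i \<Longrightarrow> a \<bullet> z k < b" "\<And>k. i < k \<Longrightarrow> k \<le> m \<Longrightarrow> b < a \<bullet> z k"
proof -
  define p q where "p = midpoint (z m) (z 1)" and "q = midpoint (z i) (z (i + 1))"
  note w = convex_position_weak[OF cp] and s = convex_positionD[OF cp]
  have mid: "4 * orient p q w = orient (z m) (z i) w + orient (z m) (z (i + 1)) w
      + orient (z 1) (z i) w + orient (z 1) (z (i + 1)) w" for w
    unfolding p_def q_def by (rule orient_midpoints)
  have low: "orient p q (z k) < 0" if k: "1 \<le> k" "k \<le> i" for k
  proof -
    have eq: "4 * orient p q (z k) = - (orient (z k) (z i) (z m) + orient (z k) (z (i + 1)) (z m)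
        + orient (z 1) (z k) (z i) + orient (z 1) (z k) (z (i + 1)))"
      unfolding mid by (simp add: orient_def algebra_simps)
    have ge: "0 \<le> orient (z k) (z i) (z m)" "0 \<le> orient (z k) (z (i + 1)) (z m)"
      "0 \<le> orient (z 1) (z k) (z i)" "0 \<le> orient (z 1) (z k) (z (i + 1))"
      using k assms by (auto intro!: w)
    \<comment> \<open>Each case makes one index triple strictly increasing. If all failed, then
      \<open>k = i = 1\<close> and \<open>m = 2\<close>, which \<open>3 \<le> m\<close>
      excludes.\<close>
    consider "i + 1 < m" | "1 < k" | "k < i" using assms k by linarith
    then have "0 < orient (z k) (z (i + 1)) (z m) \<or> 0 < orient (z 1) (z k) (z (i + 1))
        \<or> 0 < orient (z k) (z i) (z m)"
      using k assms s[of k "i + 1" m] s[of 1 k "i + 1"] s[of k i m] by cases auto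
    then show ?thesis using eq ge by linarith
  qed
  have high: "0 < orient p q (z k)" if k: "i < k" "k \<le> m" for k
  proof -
    have eq: "4 * orient p q (z k) = orient (z i) (z k) (z m) + orient (z (i + 1)) (z k) (z m)
        + orient (z 1) (z i) (z k) + orient (z 1) (z (i + 1)) (z k)"
      unfolding mid by (simp add: orient_def algebra_simps)
    have ge: "0 \<le> orient (z i) (z k) (z m)" "0 \<le> orient (z (i + 1)) (z k) (z m)"
      "0 \<le> orient (z 1) (z i) (z k)" "0 \<le> orient (z 1) (z (i + 1)) (z k)"
      using k assms by (auto intro!: w)
    consider "1 < i" | "k < m" | "i + 1 < k" using assms k by linarith
    then have "0 < orient (z 1) (z i) (z k) \<or> 0 < orient (z i) (z k) (z m)
        \<or> 0 < orient (z 1) (z (i + 1)) (z k)"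
      using k assms s[of 1 i k] s[of i k m] s[of 1 "i + 1" k] by cases auto
    then show ?thesis using eq ge by linarith
  qed
  show ?thesis
    by (rule that[of "\<i> * (q - p)" "(\<i> * (q - p)) \<bullet> p"])
      (use low high in \<open>force simp: orient_eq_inner\<close>)+
qed

section \<open>The variation factor and the variation along a list\<close>

lemma vf_line_le_vf: "is_line L \<Longrightarrow> vf_line S L \<le> vf S"
  unfolding vf_def by (rule Max_ge[OF finite_vf_line]) blast

lemma vf_le:
  assumes "\<And>L. is_line L \<Longrightarrow> vf_line S L \<le> n"
  shows "vf S \<le> n"
proof -
  have "is_line {w. (1::complex) \<bullet> w = 0}" by (rule is_line_hyperplane) simp
  then have "{vf_line S L | L. is_line L} \<noteq> {}" by blast
  then show ?thesis
    unfolding vf_def using assms by (subst Max_le_iff[OF finite_vf_line]) auto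
qed

lemma vf_pos:
  assumes "2 \<le> length S"
  shows "1 \<le> vf S"
proof -
  define L where "L = {w. (1::complex) \<bullet> w = 1 \<bullet> (S ! 0)}"
  have "crossing_segment S L 0" by (simp add: crossing_segment_def L_def)
  then have "{0} \<subseteq> {j. j < length S - 1 \<and> crossing_segment S L j}" using assms by auto
  then have "1 \<le> vf_line S L"
    using card_mono[of "{j. j < length S - 1 \<and> crossing_segment S L j}" "{0}"] assms
    by (simp add: vf_line_def)
  moreover have "is_line L" unfolding L_def by (rule is_line_hyperplane) simp
  ultimately show ?thesis using vf_line_le_vf by (meson le_trans)
qed

lemma cvar_eq: "cvar f S = (\<Sum>j<length S - 1. cmod (f (S ! Suc j) - f (S ! j)))"
  by (simp add: cvar_def sum.atLeast1_atMost_eq)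

section \<open>The upper bound\<close>

text \<open>The triangle inequality along the indices from \<open>a\<close> to \<open>b\<close>. The
  condition, symmetric in \<open>a\<close> and \<open>b\<close>, selects the gaps between
  \<open>i\<close> and \<open>i + 1\<close> that separate them; summing over all gaps suits a later
  exchange of sums.\<close>

lemma norm_diff_le_sum_between:
  fixes g :: "nat \<Rightarrow> 'a::real_normed_vector"
  assumes "a \<in> {1..m}" "b \<in> {1..m}"
  shows "norm (g b - g a) \<le>
    (\<Sum>i = 1..m - 1. if (a \<le> i) \<noteq> (b \<le> i) then norm (g i - g (i + 1)) else 0)"
proof -
  have *: "norm (g b - g a) \<le>
      (\<Sum>i = 1..m - 1. if (a \<le> i) \<noteq> (b \<le> i) then norm (g i - g (i + 1)) else 0)"
    if "a \<le> b" "1 \<le> a" "b \<le> m" for a b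
  proof -
    have "norm (g b - g a) = norm (\<Sum>i = a..<b. g (i + 1) - g i)"
      using \<open>a \<le> b\<close> by (simp add: sum_Suc_diff')
    also have "\<dots> \<le> (\<Sum>i = a..<b. norm (g i - g (i + 1)))"
      by (rule order.trans[OF norm_sum]) (simp add: norm_minus_commute)
    also have "\<dots> = (\<Sum>i = 1..m - 1. if (a \<le> i) \<noteq> (b \<le> i) then norm (g i - g (i + 1)) else 0)"
      using that by (intro sum.mono_neutral_cong_left) auto
    finally show ?thesis .
  qed
  show ?thesis
  proof (cases "a \<le> b")
    case True
    then show ?thesis using * assms by simp
  next
    case False
    have "(\<Sum>i = 1..m - 1. if (a \<le> i) \<noteq> (b \<le> i) then norm (g i - g (i + 1)) else 0) =
        (\<Sum>i = 1..m - 1. if (b \<le> i) \<noteq> (a \<le> i) then norm (g i - g (i + 1)) else 0)"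
      by (intro sum.cong) auto
    then show ?thesis using *[of b a] False assms by (simp add: norm_minus_commute)
  qed
qed

lemma card_jumps_le_vf:
  assumes cp: "convex_position m z" "3 \<le> m" "1 \<le> i" "i < m" and T: "set T \<subseteq> {1..m}"
  shows "card {j. j < length T - 1 \<and> (T ! j \<le> i) \<noteq> (T ! Suc j \<le> i)} \<le> vf (map z T)"
proof (cases "length T < 2")
  \<comment> \<open>For a single point \<open>vf_line\<close> has a rule of its own, so lists
    without segments are treated apart.\<close>
  case True
  then have "{j. j < length T - 1 \<and> (T ! j \<le> i) \<noteq> (T ! Suc j \<le> i)} = {}" by auto
  then show ?thesis by (simp only: card.empty)
next
  case False
  obtain a b where low: "\<And>k. 1 \<le> k \<Longrightarrow> k \<le> i \<Longrightarrow> a \<bullet> z k < b"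
    and high: "\<And>k. i < k \<Longrightarrow> k \<le> m \<Longrightarrow> b < a \<bullet> z k"
    using convex_position_separating_line[OF cp] by metis
  define L where "L = {w. a \<bullet> w = b}"
  have "a \<noteq> 0" using low[of 1] high[of m] assms by auto
  \<comment> \<open>A jump may go in either direction; negating the equation of \<open>L\<close>
    handles the reverse one.\<close>
  have opp: "strictly_opposite_sides L x y \<and> strictly_opposite_sides L y x"
    if "a \<bullet> x < b" "b < a \<bullet> y" for x y
    unfolding strictly_opposite_sides_def
  proof
    show "\<exists>a b. a \<noteq> 0 \<and> L = {w. a \<bullet> w = b} \<and> a \<bullet> x < b \<and> b < a \<bullet> y"
      using that \<open>a \<noteq> 0\<close> L_def by blast
    show "\<exists>a b. a \<noteq> 0 \<and> L = {w. a \<bullet> w = b} \<and> a \<bullet> y < b \<and> b < a \<bullet> x"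
      using that \<open>a \<noteq> 0\<close> by (intro exI[of _ "- a"] exI[of _ "- b"]) (auto simp: L_def)
  qed
  have "crossing_segment (map z T) L j"
    if "j < length T - 1" "(T ! j \<le> i) \<noteq> (T ! Suc j \<le> i)" for j
  proof -
    have "T ! j \<in> {1..m}" "T ! Suc j \<in> {1..m}"
      by (rule subsetD[OF T nth_mem], use that in linarith)+
    then show ?thesis
      using that low high opp[of "z (T ! j)" "z (T ! Suc j)"] opp[of "z (T ! Suc j)" "z (T ! j)"]
      by (auto simp: crossing_segment_def not_le)
  qed
  then have "card {j. j < length T - 1 \<and> (T ! j \<le> i) \<noteq> (T ! Suc j \<le> i)} \<le> vf_line (map z T) L"
    using False by (auto simp: vf_line_def intro!: card_mono)
  also have "\<dots> \<le> vf (map z T)"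
    unfolding L_def using \<open>a \<noteq> 0\<close> by (intro vf_line_le_vf is_line_hyperplane)
  finally show ?thesis .
qed

text \<open>Double counting: after the exchange of sums, the gap at \<open>i\<close> contributes
  once per jump over it, so at most \<open>vf S\<close> times.\<close>

lemma variation_le:
  assumes cp: "convex_position m z" "3 \<le> m"
  shows "variation f (z ` {1..m}) \<le> ereal (\<Sum>i = 1..m - 1. cmod (f (z i) - f (z (i + 1))))"
  unfolding variation_def
proof (rule SUP_least)
  let ?d = "\<lambda>i. cmod (f (z i) - f (z (i + 1)))"
  fix S assume "S \<in> {S. S \<noteq> [] \<and> set S \<subseteq> z ` {1..m}}"
  then have "S \<in> lists (z ` {1..m})" by auto
  then obtain T where T: "S = map z T" "set T \<subseteq> {1..m}"
    by (metis imageE in_listsI lists_image lists_eq_set mem_Collect_eq)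
  have mem: "T ! j \<in> {1..m}" if "j < length T" for j
    using T that nth_mem by blast
  let ?J = "\<lambda>i j. (T ! j \<le> i) \<noteq> (T ! Suc j \<le> i)"
  have "cvar f S = (\<Sum>j<length T - 1. cmod (f (z (T ! Suc j)) - f (z (T ! j))))"
    by (simp add: cvar_eq T)
  also have "\<dots> \<le> (\<Sum>j<length T - 1. \<Sum>i = 1..m - 1. if ?J i j then ?d i else 0)"
  proof (rule sum_mono)
    fix j assume "j \<in> {..<length T - 1}"
    then show "cmod (f (z (T ! Suc j)) - f (z (T ! j))) \<le> (\<Sum>i = 1..m - 1. if ?J i j then ?d i else 0)"
      using norm_diff_le_sum_between[of "T ! j" m "T ! Suc j" "\<lambda>i. f (z i)"] mem by simp
  qed
  also have "\<dots> = (\<Sum>i = 1..m - 1. \<Sum>j<length T - 1. if ?J i j then ?d i else 0)"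
    by (rule sum.swap)
  also have "\<dots> = (\<Sum>i = 1..m - 1. ?d i * real (card {j. j < length T - 1 \<and> ?J i j}))"
    by (intro sum.cong refl) (simp add: sum.If_cases Int_def conj_commute mult.commute)
  also have "\<dots> \<le> (\<Sum>i = 1..m - 1. ?d i * real (vf S))"
    using card_jumps_le_vf[OF cp _ _ T(2)] T(1) cp by (intro sum_mono mult_left_mono) auto
  finally have "cvar f S \<le> (\<Sum>i = 1..m - 1. ?d i) * real (vf S)"
    by (simp add: sum_distrib_right)
  \<comment> \<open>Division by zero yields 0, so in that case the bound only has to be
    nonnegative.\<close>
  then show "ereal (cvar f S / real (vf S)) \<le> ereal (\<Sum>i = 1..m - 1. ?d i)"
    by (cases "vf S = 0") (auto simp: field_simps intro: sum_nonneg)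
qed

section \<open>Sign changes around the polygon\<close>

text \<open>By \<open>orient_relation_inner\<close>, positive combinations of the values at
  \<open>z i\<close>, \<open>z k\<close> and at \<open>z j\<close>, \<open>z l\<close> agree and
  have equal total weight; the first would exceed that weight times \<open>b\<close>, the second
  would not.\<close>

lemma convex_position_no_alternation:
  assumes cp: "convex_position m z" and ord: "1 \<le> i" "i < j" "j < k" "k < l" "l \<le> m"
    and "a \<bullet> z i > b" "a \<bullet> z j \<le> b" "a \<bullet> z k > b" "a \<bullet> z l \<le> b"
  shows False
proof -
  note s = convex_positionD[OF cp]
  let ?A = "orient (z j) (z k) (z l)" and ?B = "orient (z i) (z k) (z l)"
    and ?C = "orient (z i) (z j) (z l)" and ?D = "orient (z i) (z j) (z k)"
  have "(?A + ?C) * b < ?A * (a \<bullet> z i) + ?C * (a \<bullet> z k)"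
    unfolding distrib_right
    using s[of j k l] s[of i j l] ord assms by (intro add_strict_mono mult_strict_left_mono) auto
  also have "\<dots> = ?B * (a \<bullet> z j) + ?D * (a \<bullet> z l)" by (rule orient_relation_inner)
  also have "\<dots> \<le> (?B + ?D) * b"
    unfolding distrib_right
    using s[of i k l] s[of i j k] ord assms by (intro add_mono mult_left_mono) auto
  finally show False by (simp add: orient_relation)
qed

text \<open>Negating \<open>a\<close> and \<open>b\<close> in the previous pattern would leave the
  strict inequalities at \<open>i\<close> and \<open>k\<close>, so the shifted pattern is treated by
  itself.\<close>

lemma convex_position_no_alternation':
  assumes cp: "convex_position m z" and ord: "1 \<le> i" "i < j" "j < k" "k < l" "l \<le> m"
    and "a \<bullet> z i \<le> b" "a \<bullet> z j > b" "a \<bullet> z k \<le> b" "a \<bullet> z l > b"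
  shows False
proof -
  note s = convex_positionD[OF cp]
  let ?A = "orient (z j) (z k) (z l)" and ?B = "orient (z i) (z k) (z l)"
    and ?C = "orient (z i) (z j) (z l)" and ?D = "orient (z i) (z j) (z k)"
  have "(?B + ?D) * b < ?B * (a \<bullet> z j) + ?D * (a \<bullet> z l)"
    unfolding distrib_right
    using s[of i k l] s[of i j k] ord assms by (intro add_strict_mono mult_strict_left_mono) auto
  also have "\<dots> = ?A * (a \<bullet> z i) + ?C * (a \<bullet> z k)" by (rule orient_relation_inner[symmetric])
  also have "\<dots> \<le> (?A + ?C) * b"
    unfolding distrib_right
    using s[of j k l] s[of i j l] ord assms by (intro add_mono mult_left_mono) auto
  finally show False by (simp add: orient_relation)
qed

text \<open>Here \<open>p\<close> counts from 0, and \<open>Suc p mod m + 1\<close> is the cyclic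
  successor of \<open>p + 1\<close>. Two exits from the open half-plane would produce four
  alternating vertices.\<close>

lemma convex_position_unique_exit:
  assumes cp: "convex_position m z" and "p < m" "q < m"
    and "a \<bullet> z (p + 1) > b" "a \<bullet> z (Suc p mod m + 1) \<le> b"
    and "a \<bullet> z (q + 1) > b" "a \<bullet> z (Suc q mod m + 1) \<le> b"
  shows "p = q"
proof -
  have False if "p < q" "q < m"
    and "a \<bullet> z (p + 1) > b" "a \<bullet> z (Suc p mod m + 1) \<le> b"
    and "a \<bullet> z (q + 1) > b" "a \<bullet> z (Suc q mod m + 1) \<le> b" for p q
  proof -
    have "Suc p mod m = Suc p" using that by simp
    \<comment> \<open>If \<open>Suc p = q\<close>, the value at \<open>z (q + 1)\<close> would be
      both above \<open>b\<close> and at most \<open>b\<close>.\<close>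
    with that have pq: "Suc p < q" "a \<bullet> z (p + 2) \<le> b" by (cases "Suc p = q"; simp)+
    show False
    proof (cases "Suc q = m")
      case True
      \<comment> \<open>The successor of the last vertex is \<open>z 1\<close>, so the alternation
        begins there with a low value.\<close>
      then have "a \<bullet> z 1 \<le> b" using that by simp
      moreover from this have "p \<noteq> 0" using that by (cases p) auto
      ultimately show ?thesis
        using convex_position_no_alternation'[OF cp, of 1 "p + 1" "p + 2" "q + 1" a b] that pq True
        by simp
    next
      case False
      then have "Suc q mod m = Suc q" using that by simp
      then show ?thesis
        using convex_position_no_alternation[OF cp, of "p + 1" "p + 2" "q + 1" "q + 2" b a]
          that pq False by simp
    qed
  qed
  then show ?thesis using assms by (metis linorder_neqE_nat)
qed

text \<open>Each round has at most one exit, and \<open>j div m\<close> numbers the rounds.\<close>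

lemma convex_position_card_exits:
  assumes cp: "convex_position m z"
  shows "card {j. j < N * m \<and> a \<bullet> z (j mod m + 1) > b \<and> a \<bullet> z (Suc j mod m + 1) \<le> b} \<le> N"
    (is "card ?E \<le> N")
proof (cases "m = 0")
  case False
  have "inj_on (\<lambda>j. j div m) ?E"
  proof (rule inj_onI)
    fix i j assume "i \<in> ?E" "j \<in> ?E" and div: "i div m = j div m"
    then have "i mod m = j mod m"
      using False by (intro convex_position_unique_exit[OF cp]) (auto simp: mod_Suc_eq)
    with div show "i = j" by (metis div_mult_mod_eq)
  qed
  moreover have "(\<lambda>j. j div m) ` ?E \<subseteq> {..<N}"
    by (auto simp: less_mult_imp_div_less)
  ultimately show ?thesis using card_inj_on_le[of _ ?E "{..<N}"] by simp
qed simp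

text \<open>Strict start and weak end reflect that arriving on the line counts but leaving it does
  not. \<open>strictly_opposite_sides\<close> may use another equation of the line, so the signs for
  the given one come from a point where the segment meets the line.\<close>

lemma crossing_segment_sign_change:
  assumes "crossing_segment S {w. a \<bullet> w = b} j" "j \<noteq> 0"
  shows "(a \<bullet> S ! j > b \<and> a \<bullet> S ! Suc j \<le> b) \<or> (a \<bullet> S ! j < b \<and> a \<bullet> S ! Suc j \<ge> b)"
proof (cases "strictly_opposite_sides {w. a \<bullet> w = b} (S ! j) (S ! Suc j)")
  case True
  let ?x = "S ! j" and ?y = "S ! Suc j"
  from True obtain c d where L: "{w. a \<bullet> w = b} = {w. c \<bullet> w = d}" and cd: "c \<bullet> ?x < d" "d < c \<bullet> ?y"
    by (auto simp: strictly_opposite_sides_def)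
  have off: "a \<bullet> ?x \<noteq> b" "a \<bullet> ?y \<noteq> b" using L cd by (auto simp: set_eq_iff)
  \<comment> \<open>The parameter at which \<open>c \<bullet> w\<close> takes the value
    \<open>d\<close> along the segment.\<close>
  define t where "t = (d - c \<bullet> ?x) / (c \<bullet> ?y - c \<bullet> ?x)"
  have t: "0 < t" "t < 1" using cd by (auto simp: t_def field_simps)
  have "t * (c \<bullet> ?y - c \<bullet> ?x) = d - c \<bullet> ?x" using cd by (simp add: t_def)
  then have "c \<bullet> ((1 - t) *\<^sub>R ?x + t *\<^sub>R ?y) = d" by (simp add: inner_add_right algebra_simps)
  then have "a \<bullet> ((1 - t) *\<^sub>R ?x + t *\<^sub>R ?y) = b" using L by blast
  then have "(1 - t) * (a \<bullet> ?x - b) + t * (a \<bullet> ?y - b) = 0"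
    by (simp add: inner_add_right algebra_simps)
  moreover have "0 < (1 - t) * (a \<bullet> ?x - b) + t * (a \<bullet> ?y - b)" if "a \<bullet> ?x > b" "a \<bullet> ?y > b"
    using that t by (intro add_pos_pos mult_pos_pos) auto
  moreover have "(1 - t) * (a \<bullet> ?x - b) + t * (a \<bullet> ?y - b) < 0" if "a \<bullet> ?x < b" "a \<bullet> ?y < b"
    using that t by (intro add_neg_neg mult_pos_neg) auto
  ultimately show ?thesis using off by fastforce
next
  case False
  then show ?thesis using assms by (auto simp: crossing_segment_def)
qed

section \<open>Walks around the boundary\<close>

text \<open>The final \<open>+ 1\<close> includes the last return to \<open>z 1\<close>, so
  \<open>N\<close> rounds have \<open>N * m\<close> segments.\<close>

definition winding_list :: "nat \<Rightarrow> (nat \<Rightarrow> complex) \<Rightarrow> nat \<Rightarrow> complex list" where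
  "winding_list m z N = map (\<lambda>j. z (j mod m + 1)) [0..<N * m + 1]"

lemma length_winding_list: "length (winding_list m z N) = N * m + 1"
  by (simp add: winding_list_def)

lemma winding_list_nth: "j \<le> N * m \<Longrightarrow> winding_list m z N ! j = z (j mod m + 1)"
  unfolding winding_list_def by (subst nth_map) (auto simp del: upt_Suc)

lemma vf_winding_list_le:
  assumes cp: "convex_position m z"
  shows "vf (winding_list m z N) \<le> 2 * N + 1"
proof (rule vf_le)
  let ?S = "winding_list m z N"
  fix L assume "is_line L"
  then obtain a b where L: "L = {w. a \<bullet> w = b}" by (rule is_lineE)
  let ?E = "\<lambda>a b. {j. j < N * m \<and> a \<bullet> z (j mod m + 1) > b \<and> a \<bullet> z (Suc j mod m + 1) \<le> b}"
  \<comment> \<open>Segment 0 is set apart, as it also counts when it merely starts on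
    \<open>L\<close>. The others leave one of the two open half-planes, given by \<open>a\<close>,
    \<open>b\<close> and by \<open>- a\<close>, \<open>- b\<close>.\<close>
  have "{j. j < N * m \<and> crossing_segment ?S L j} \<subseteq> insert 0 (?E a b \<union> ?E (- a) (- b))"
  proof
    fix j assume "j \<in> {j. j < N * m \<and> crossing_segment ?S L j}"
    then have j: "j < N * m" "crossing_segment ?S {w. a \<bullet> w = b} j" by (auto simp: L)
    then have "?S ! j = z (j mod m + 1)" "?S ! Suc j = z (Suc j mod m + 1)"
      using winding_list_nth[of j N m z] winding_list_nth[of "Suc j" N m z] by linarith+
    then show "j \<in> insert 0 (?E a b \<union> ?E (- a) (- b))"
      using crossing_segment_sign_change[OF j(2)] j(1) by (cases "j = 0") auto
  qed
  then have "card {j. j < N * m \<and> crossing_segment ?S L j}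
      \<le> card (insert 0 (?E a b \<union> ?E (- a) (- b)))"
    by (intro card_mono) auto
  also have "\<dots> \<le> Suc (card (?E a b) + card (?E (- a) (- b)))"
    using card_Un_le[of "?E a b" "?E (- a) (- b)"] by (simp add: card_insert_if)
  also have "\<dots> \<le> 2 * N + 1"
    using convex_position_card_exits[OF cp, of N b a]
      convex_position_card_exits[OF cp, of N "- b" "- a"] by linarith
  finally show "vf_line ?S L \<le> 2 * N + 1"
    by (auto simp: vf_line_def length_winding_list)
qed

lemma cvar_winding_list:
  assumes "0 < m"
  shows "cvar f (winding_list m z N) =
    real N * (cmod (f (z m) - f (z 1)) + (\<Sum>i = 1..m - 1. cmod (f (z i) - f (z (i + 1)))))"
proof -
  let ?h = "\<lambda>j. cmod (f (z (Suc j mod m + 1)) - f (z (j mod m + 1)))"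
  obtain n where n: "m = Suc n" using assms by (cases m) auto
  have "sum ?h {..<m} = (\<Sum>j<n. ?h j) + ?h n" by (simp add: n)
  also have "(\<Sum>j<n. ?h j) = (\<Sum>j<n. cmod (f (z (Suc j)) - f (z (Suc j + 1))))"
    by (intro sum.cong) (auto simp: n norm_minus_commute)
  also have "\<dots> = (\<Sum>i = 1..m - 1. cmod (f (z i) - f (z (i + 1))))"
    using sum.atLeast1_atMost_eq[of "\<lambda>i. cmod (f (z i) - f (z (i + 1)))" n] by (simp add: n)
  also have "?h n = cmod (f (z m) - f (z 1))" by (simp add: n norm_minus_commute)
  finally have round: "sum ?h {..<m} =
    cmod (f (z m) - f (z 1)) + (\<Sum>i = 1..m - 1. cmod (f (z i) - f (z (i + 1))))" by simp
  have "cvar f (winding_list m z N) = sum ?h {..<N * m}"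
    unfolding cvar_eq by (intro sum.cong) (auto simp: length_winding_list winding_list_nth)
  also have "\<dots> = real N * sum ?h {..<m}"
  proof (induction N)
    case (Suc N)
    have "sum ?h {..<Suc N * m} = sum ?h {..<N * m} + sum ?h {N * m..<N * m + m}"
      by (simp add: sum.atLeastLessThan_concat lessThan_atLeast0 add.commute)
    \<comment> \<open>Shifting by a multiple of \<open>m\<close> leaves the residues
      unchanged.\<close>
    also have "sum ?h {N * m..<N * m + m} = sum ?h {..<m}"
      using sum.shift_bounds_nat_ivl[of ?h 0 "N * m" m]
      by (simp add: lessThan_atLeast0 add.commute flip: add_Suc)
    finally show ?case using Suc by (simp add: algebra_simps)
  qed simp
  finally show ?thesis using round by simp
qed

section \<open>The lower bound\<close>

lemma variation_ge:
  assumes cp: "convex_position m z" and "0 < m"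
  shows "ereal (1 / 2 * (cmod (f (z m) - f (z 1)) + (\<Sum>i = 1..m - 1. cmod (f (z i) - f (z (i + 1))))))
           \<le> variation f (z ` {1..m})"
proof -
  define C where "C = cmod (f (z m) - f (z 1)) + (\<Sum>i = 1..m - 1. cmod (f (z i) - f (z (i + 1))))"
  have "0 \<le> C" unfolding C_def by (intro add_nonneg_nonneg sum_nonneg) auto
  have "ereal (real N * C / real (2 * N + 1)) \<le> variation f (z ` {1..m})" if "1 \<le> N" for N
  proof -
    let ?S = "winding_list m z N"
    have "2 \<le> length ?S" using that \<open>0 < m\<close> by (simp add: length_winding_list Suc_le_eq)
    then have "1 \<le> vf ?S" by (rule vf_pos)
    \<comment> \<open>As \<open>vf ?S\<close> is positive, replacing it in the denominator by
      \<open>2 * N + 1\<close> can only decrease the quotient.\<close>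
    then have "real N * C / real (2 * N + 1) \<le> cvar f ?S / real (vf ?S)"
      using vf_winding_list_le[OF cp, of N] \<open>0 \<le> C\<close> \<open>0 < m\<close>
      unfolding cvar_winding_list[OF \<open>0 < m\<close>] C_def[symmetric]
      by (intro divide_left_mono) (auto simp flip: of_nat_Suc of_nat_mult)
    also have "ereal \<dots> \<le> variation f (z ` {1..m})"
      unfolding variation_def using \<open>0 < m\<close>
      by (intro SUP_upper) (auto simp: winding_list_def Suc_le_eq simp del: upt_Suc)
    finally show ?thesis by simp
  qed
  moreover have "(\<lambda>N. real N * C / real (2 * N + 1)) \<longlonglongrightarrow> 1 / 2 * C"
    by real_asymp
  then have "(\<lambda>N. ereal (real N * C / real (2 * N + 1))) \<longlonglongrightarrow> ereal (1 / 2 * C)"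
    by (intro tendsto_ereal)
  ultimately have "ereal (1 / 2 * C) \<le> variation f (z ` {1..m})"
    by (intro LIMSEQ_le_const2) blast+
  then show ?thesis by (simp add: C_def)
qed

theorem theorem2p24:
  fixes P \<sigma> :: "complex set" and m :: nat and z :: "nat \<Rightarrow> complex"
    and f :: "complex \<Rightarrow> complex"
  assumes "convex_polygon P"
    and "anticlockwise_vertices P m z"
    and "\<sigma> = z ` {1..m}"
  shows "ereal (1 / 2 * (cmod (f (z m) - f (z 1)) + (\<Sum>i = 1..m - 1. cmod (f (z i) - f (z (i + 1))))))
           \<le> variation f \<sigma>
         \<and> variation f \<sigma> \<le> ereal (\<Sum>i = 1..m - 1. cmod (f (z i) - f (z (i + 1))))"
proof -
  have cp: "convex_position m z" and m: "3 \<le> m"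
    using polygon_convex_position polygon_vertex_count assms by blast+
  from m have "0 < m" by simp
  then show ?thesis
    unfolding assms(3) by (intro conjI variation_ge[OF cp] variation_le[OF cp m])
qed

end
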